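(* Let $\Sigma$ be a signature, let $P$ be a logic program over $\Sigma$, let $C$ be a clause over $\Sigma$, and let $\theta,\sigma$ be substitutions over $\Sigma$. Then $$\theta(\mathrm{rew}(P,C,\sigma)) = \mathrm{rew}(P,C,\theta\sigma),$$ where $\theta(\cdot)$ on the left is the Tier 2 substitution of a rewriting tree and both rewriting trees are built under the renaming-apart convention for existential variables described in the context.
   Context: Words and tree languages: $\mathbb{N}^*$ is the set of finite words over $\mathbb{N}$, $\epsilon$ the empty word, $wu$ concatenation. A tree language is a set $L\subseteq\mathbb{N}^*$ such that if $wj\in L$ then $w\in L$ and $wi\in L$ for all $i<j$, and for each $w\in L$ the set $\{i\mid wi\in L\}$ is finite. Term trees: a signature $\Sigma$ is a non-empty set of function symbols with arities; $\mathit{Var}$ is a countably infinite set of variables of arity $0$ disjoint from $\Sigma$. A term tree over $\Sigma$ is a function $t:L\to\Sigma\cup\mathit{Var}$, $L$ a non-empty tree language, with $\mathit{arity}(t(w))=|\{i\mid wi\in L\}|$ for all $w\in L$. $\mathbf{Term}(\Sigma)$ is the set of finite term trees. A substitution is a total map $\sigma:\mathit{Var}\to\mathbf{Term}(\Sigma)$, extended to term trees homomorphically (replacing variable leaves by term trees); composition is written by juxtaposition ($\sigma_2\sigma_1(t)=\sigma_2(\sigma_1(t))$). $\sigma$ is a matcher of $t$ against $u$ if $\sigma(t)=u$; a most general matcher (mgm) is a matcher more general than every matcher ($\sigma_1\le\sigma_2$ iff $\sigma\sigma_1=\sigma_2$ on variables for some $\sigma$). We write $t\prec_\theta u$ if $\theta$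 is an mgm of $t$ against $u$. Clauses and programs: a clause $A\gets B_0,\dots,B_n$ over $\Sigma$ is viewed as a function $C$ from the tree language $\{\epsilon,0,\dots,n\}$ to $\mathbf{Term}(\Sigma)$ with $C(\epsilon)=A=\mathit{head}(C)$ and $C(i)=B_i$. A goal clause $?\gets B_0,\dots,B_n$ (with $?$ a special symbol not in $\Sigma\cup\mathit{Var}$) also counts as a clause. $\mathbf{Clause}(\Sigma)$ is the set of clauses. A logic program over $\Sigma$ is a function $P$ from some $\{0,\dots,n\}\subseteq\mathbb{N}$ to non-goal clauses. Substitutions are applied to clauses componentwise. A variable of a clause is existential if it occurs in the body but not the head. Renaming convention: clause variables are renamed apart (fresh) when computing mgms. Moreover $\mathit{Var}$ is partitioned into disjoint sets $V_U$ and $V_E$; when, at node $wi$ of a rewriting tree $T$, the clause $P(i)$ with existential variables $Z_1,\dots,Z_n$ is matched via $\theta$ against $T(w)$ to form $\theta(P(i))$, each $Z_k$ is renamed to the variable $E^k_{wi}\in V_E$ (indexed by the node $wi$ and $k$), while other variables are renamed using $V_U$; $\theta(P(i))$ is understood to include this renaming. Rewriting trees: let $V_R$ be a countably infinite set of variables disjoint from $\mathit{Var}$. For a program $P$, a clause $C$ and an idempotent substitution $\sigma$ ($\sigma\sigma=\sigma$), $\mathrm{rew}(P,C,\sigma)$ is the function $T:\mathit{dom}(T)\to\mathbf{Term}(\Sigma)\cup\mathbf{Clause}(\Sigma)\cup V_R$, $\mathit{dom}(T)$ a non-empty tree language, such that: (1) $T(\epsilon)=\sigma(C)$ and $T(i)=\sigma(C(i))$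 for each body position $i$ of $C$; (2) for $|w|$ odd, $T(w)\in\mathbf{Term}(\Sigma)$ and for every $i\in\mathit{dom}(P)$, $wi\in\mathit{dom}(T)$ with $T(wi)=\sigma(\theta(P(i)))$ if $\mathit{head}(P(i))\prec_\theta T(w)$, and $T(wi)$ a fresh variable in $V_R$ otherwise; (3) for $|w|$ even and $>0$: if $T(w)\in V_R$ then $w$ has no children; if $T(w)$ is a clause $\sigma(\theta(P(i)))$ as in (2), then for every body position $j$ of $P(i)$, $wj\in\mathit{dom}(T)$ and $T(wj)=\sigma(\theta(P(i)(j)))$; (4) no other words are in $\mathit{dom}(T)$. Nodes at odd depth are and-nodes, nodes at even depth are or-nodes. Tier 2 substitution: for $T=\mathrm{rew}(P,C,\sigma)$ and an idempotent substitution $\sigma'$, the rewriting tree $\sigma'(T)$ is defined by: for every $w$ with $T(w)$ an and-node or an or-node not in $V_R$, $(\sigma'(T))(w)=\sigma'(T(w))$; for every $wi$ with $T(wi)\in V_R$, if $\theta$ is an mgm of $\mathit{head}(P(i))$ against $(\sigma'(T))(w)$ then $(\sigma'(T))(wiv)=\mathrm{rew}(P,\theta(P(i)),\sigma'\sigma)(v)$ for all $v$ in the domain of the latter (including $v=\epsilon$), and if no such mgm exists then $(\sigma'(T))(wi)=T(wi)$. *)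

theory Defs
  imports Main
begin

section \<open>Term trees\<close>

definition tree_language :: "nat list set \<Rightarrow> bool" where
  "tree_language L \<longleftrightarrow>
     (\<forall>w j. w @ [j] \<in> L \<longrightarrow> w \<in> L \<and> (\<forall>i<j. w @ [i] \<in> L)) \<and>
     (\<forall>w\<in>L. finite {i. w @ [i] \<in> L})"

text \<open>The symbols of a signature are the elements of its domain, its values are the arities.\<close>

type_synonym 'f signature = "'f \<rightharpoonup> nat"

text \<open>The constructors give the partition of the variables into \<open>V\<^sub>U\<close> and \<open>V\<^sub>E\<close>:
  \<open>VE w k\<close> is the variable \<open>E\<^sup>k\<^sub>w\<close>, where \<open>w\<close> is a node of a rewriting tree.\<close>

datatype var = VU nat | VE "nat list" nat

datatype 'f sym = Fn 'f | V var

type_synonym 'f ttree = "nat list \<rightharpoonup> 'f sym"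

fun has_arity :: "'f signature \<Rightarrow> 'f sym \<Rightarrow> nat \<Rightarrow> bool" where
  "has_arity \<Sigma> (Fn f) n \<longleftrightarrow> \<Sigma> f = Some n"
| "has_arity \<Sigma> (V x) n \<longleftrightarrow> n = 0"

definition term_tree :: "'f signature \<Rightarrow> 'f ttree \<Rightarrow> bool" where
  "term_tree \<Sigma> t \<longleftrightarrow> dom t \<noteq> {} \<and> tree_language (dom t) \<and>
     (\<forall>w s. t w = Some s \<longrightarrow> has_arity \<Sigma> s (card {i. w @ [i] \<in> dom t}))"

definition Term :: "'f signature \<Rightarrow> 'f ttree set" where
  "Term \<Sigma> = {t. term_tree \<Sigma> t \<and> finite (dom t)}"

definition tvars :: "'f ttree \<Rightarrow> var set" where
  "tvars t = {x. \<exists>w. t w = Some (V x)}"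

definition tvar :: "var \<Rightarrow> 'f ttree" where
  "tvar x = [[] \<mapsto> V x]"


section \<open>Substitutions and matching\<close>

type_synonym 'f subst = "var \<Rightarrow> 'f ttree"

definition is_subst :: "'f signature \<Rightarrow> 'f subst \<Rightarrow> bool" where
  "is_subst \<Sigma> \<sigma> \<longleftrightarrow> (\<forall>x. \<sigma> x \<in> Term \<Sigma>)"

text \<open>If the root of \<open>t\<close> is a variable, then \<open>t\<close> is replaced as a whole; otherwise the root symbol
  is kept and the substitution is applied to the immediate subtrees \<open>\<lambda>v. t (i # v)\<close>.\<close>

fun tsubst :: "'f subst \<Rightarrow> 'f ttree \<Rightarrow> 'f ttree" where
  "tsubst \<sigma> t [] = (case t [] of Some (V x) \<Rightarrow> \<sigma> x [] | _ \<Rightarrow> t [])"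
| "tsubst \<sigma> t (i # w) =
     (case t [] of Some (V x) \<Rightarrow> \<sigma> x (i # w) | _ \<Rightarrow> tsubst \<sigma> (\<lambda>v. t (i # v)) w)"

definition comp_subst :: "'f subst \<Rightarrow> 'f subst \<Rightarrow> 'f subst" (infixl "\<odot>" 70) where
  "\<tau> \<odot> \<sigma> = (\<lambda>x. tsubst \<tau> (\<sigma> x))"

definition idem :: "'f subst \<Rightarrow> bool" where
  "idem \<sigma> \<longleftrightarrow> \<sigma> \<odot> \<sigma> = \<sigma>"

definition matcher :: "'f signature \<Rightarrow> 'f subst \<Rightarrow> 'f ttree \<Rightarrow> 'f ttree \<Rightarrow> bool" where
  "matcher \<Sigma> \<sigma> t u \<longleftrightarrow> is_subst \<Sigma> \<sigma> \<and> tsubst \<sigma> t = u"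

definition more_general :: "'f signature \<Rightarrow> 'f subst \<Rightarrow> 'f subst \<Rightarrow> bool" where
  "more_general \<Sigma> \<sigma>\<^sub>1 \<sigma>\<^sub>2 \<longleftrightarrow> (\<exists>\<sigma>. is_subst \<Sigma> \<sigma> \<and> \<sigma> \<odot> \<sigma>\<^sub>1 = \<sigma>\<^sub>2)"

definition mgm :: "'f signature \<Rightarrow> 'f subst \<Rightarrow> 'f ttree \<Rightarrow> 'f ttree \<Rightarrow> bool" where
  "mgm \<Sigma> \<theta> t u \<longleftrightarrow> matcher \<Sigma> \<theta> t u \<and> (\<forall>\<tau>. matcher \<Sigma> \<tau> t u \<longrightarrow> more_general \<Sigma> \<theta> \<tau>)"


section \<open>Clauses and programs\<close>

text \<open>The head \<open>None\<close> stands for the symbol \<open>?\<close> of goal clauses. The body may be empty, so that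
  facts are clauses.\<close>

datatype 'f clause = Clause (head: "'f ttree option") (body: "'f ttree list")

definition is_clause :: "'f signature \<Rightarrow> 'f clause \<Rightarrow> bool" where
  "is_clause \<Sigma> C \<longleftrightarrow> set_option (head C) \<subseteq> Term \<Sigma> \<and> set (body C) \<subseteq> Term \<Sigma>"

definition is_program :: "'f signature \<Rightarrow> 'f clause list \<Rightarrow> bool" where
  "is_program \<Sigma> P \<longleftrightarrow> P \<noteq> [] \<and> (\<forall>C\<in>set P. is_clause \<Sigma> C \<and> head C \<noteq> None)"

definition csubst :: "'f subst \<Rightarrow> 'f clause \<Rightarrow> 'f clause" where
  "csubst \<sigma> C = Clause (map_option (tsubst \<sigma>) (head C)) (map (tsubst \<sigma>) (body C))"

definition existentials :: "'f clause \<Rightarrow> var set" where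
  "existentials C = (\<Union>t\<in>set (body C). tvars t) - (\<Union>t\<in>set_option (head C). tvars t)"

text \<open>A fixed enumeration \<open>Z\<^sub>1, \<dots>, Z\<^sub>n\<close> of the existential variables of \<open>C\<close>, represented by the map
  from \<open>Z\<^sub>k\<close> to \<open>k\<close>.\<close>

definition ex_index :: "'f clause \<Rightarrow> var \<Rightarrow> nat" where
  "ex_index C = (SOME f. bij_betw f (existentials C) {1..card (existentials C)})"

text \<open>The matcher \<open>\<theta>\<close> together with the renaming of the existential variables \<open>Z\<^sub>k\<close> of \<open>C\<close> to
  \<open>E\<^sup>k\<^sub>w\<close>. The other variables of a program clause occur in its head. A matcher of the head is
  determined on them, and renaming them beforehand to fresh elements of \<open>V\<^sub>U\<close> does not change
  the instance of the clause, so that renaming is not represented.\<close>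

definition node_subst :: "'f subst \<Rightarrow> 'f clause \<Rightarrow> nat list \<Rightarrow> 'f subst" where
  "node_subst \<theta> C w = (\<lambda>x. if x \<in> existentials C then tvar (VE w (ex_index C x)) else \<theta> x)"

text \<open>\<open>Some (\<theta>(C))\<close>, formed at node \<open>w\<close>, if \<open>\<theta>\<close> is an mgm of the head of \<open>C\<close> against \<open>t\<close>;
  \<open>None\<close> if there is no mgm. By \<open>node_instance_eq\<close> below the choice of the mgm is irrelevant.\<close>

definition node_instance ::
  "'f signature \<Rightarrow> 'f clause \<Rightarrow> 'f ttree \<Rightarrow> nat list \<Rightarrow> 'f clause option" where
  "node_instance \<Sigma> C t w =
     (if \<exists>\<theta>. mgm \<Sigma> \<theta> (the (head C)) t
      then Some (csubst (node_subst (SOME \<theta>. mgm \<Sigma> \<theta> (the (head C)) t) C w) C)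
      else None)"


lemma tsubst_cong:
  assumes "\<And>x. x \<in> tvars t \<Longrightarrow> \<sigma> x = \<tau> x"
  shows "tsubst \<sigma> t = tsubst \<tau> t"
proof
  fix w show "tsubst \<sigma> t w = tsubst \<tau> t w"
    using assms
  proof (induction w arbitrary: t)
    case Nil
    have "\<sigma> x = \<tau> x" if "t [] = Some (V x)" for x
      using that Nil.prems by (auto simp: tvars_def)
    then show ?case by (auto split: option.splits sym.splits)
  next
    case (Cons i w)
    have "tsubst \<sigma> (\<lambda>v. t (i # v)) w = tsubst \<tau> (\<lambda>v. t (i # v)) w"
      by (rule Cons.IH) (auto simp: tvars_def intro!: Cons.prems)
    moreover have "\<sigma> x = \<tau> x" if "t [] = Some (V x)" for x
      using that Cons.prems by (auto simp: tvars_def)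
    ultimately show ?case by (auto split: option.splits sym.splits)
  qed
qed

lemma tsubst_leaf:
  assumes "t u = Some (V x)" and "\<And>u1 i u2 y. u = u1 @ i # u2 \<Longrightarrow> t u1 \<noteq> Some (V y)"
  shows "tsubst \<sigma> t (u @ v) = \<sigma> x v"
  using assms
proof (induction u arbitrary: t)
  case Nil
  then show ?case by (cases v) auto
next
  case (Cons i u)
  have "t [] \<noteq> Some (V y)" for y using Cons.prems(2)[of "[]" i u] by simp
  moreover have "tsubst \<sigma> (\<lambda>v. t (i # v)) (u @ v) = \<sigma> x v"
  proof (rule Cons.IH)
    show "t (i # u) = Some (V x)" by fact
    show "t (i # u1) \<noteq> Some (V y)" if "u = u1 @ j # u2" for u1 j u2 y
      using Cons.prems(2)[of "i # u1" j u2 y] that by simp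
  qed
  ultimately show ?case by (auto split: option.splits sym.splits)
qed

lemma tree_language_prefix:
  assumes "tree_language L" and "u @ v \<in> L"
  shows "u \<in> L"
  using assms(2)
proof (induction v rule: rev_induct)
  case (snoc i v)
  then show ?case using assms(1) unfolding tree_language_def by (metis append.assoc)
qed simp

lemma tsubst_Term_leaf:
  assumes "t \<in> Term \<Sigma>" and "t u = Some (V x)"
  shows "tsubst \<sigma> t (u @ v) = \<sigma> x v"
proof (rule tsubst_leaf)
  show "t u1 \<noteq> Some (V y)" if u: "u = u1 @ i # u2" for u1 i u2 y
  proof
    assume y: "t u1 = Some (V y)"
    have L: "tree_language (dom t)" using assms(1) by (simp add: Term_def term_tree_def)
    have "(u1 @ [i]) @ u2 \<in> dom t" using assms(2) u by auto
    then have i: "u1 @ [i] \<in> dom t" using L tree_language_prefix by blast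
    have "card {i. u1 @ [i] \<in> dom t} = 0"
      using assms(1) y by (fastforce simp: Term_def term_tree_def)
    moreover have "finite {i. u1 @ [i] \<in> dom t}"
      using L y unfolding tree_language_def by blast
    ultimately show False using i by auto
  qed
qed fact

lemma matchers_agree:
  assumes "t \<in> Term \<Sigma>" and "tsubst \<sigma> t = tsubst \<tau> t" and "x \<in> tvars t"
  shows "\<sigma> x = \<tau> x"
proof
  fix v
  from assms(3) obtain u where "t u = Some (V x)" by (auto simp: tvars_def)
  then show "\<sigma> x v = \<tau> x v" using tsubst_Term_leaf[OF assms(1)] assms(2) by metis
qed

lemma csubst_node_subst_cong:
  assumes "is_clause \<Sigma> C" and "head C = Some h" and "tsubst \<theta> h = tsubst \<tau> h"
  shows "csubst (node_subst \<theta> C w) C = csubst (node_subst \<tau> C w) C"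
proof -
  have "node_subst \<theta> C w x = node_subst \<tau> C w x"
    if "x \<in> tvars h \<or> (\<exists>t\<in>set (body C). x \<in> tvars t)" for x
    using that assms matchers_agree[of h \<Sigma> \<theta> \<tau> x]
    by (auto simp: is_clause_def node_subst_def existentials_def)
  then show ?thesis using assms(2) by (auto simp: csubst_def intro!: tsubst_cong)
qed

lemma node_instance_eq:
  assumes "is_clause \<Sigma> C" and "head C = Some h" and "mgm \<Sigma> \<theta> h t"
  shows "node_instance \<Sigma> C t w = Some (csubst (node_subst \<theta> C w) C)"
proof -
  have "mgm \<Sigma> (SOME \<theta>. mgm \<Sigma> \<theta> h t) h t" using assms(3) by (rule someI[of "\<lambda>\<theta>. mgm \<Sigma> \<theta> h t"])
  then show ?thesis using assms
    by (auto simp: node_instance_def mgm_def matcher_def intro!: csubst_node_subst_cong)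
qed


section \<open>Rewriting trees\<close>

text \<open>\<open>VR w\<close> is the fresh variable of \<open>V\<^sub>R\<close> introduced at node \<open>w\<close>.\<close>

datatype rvar = VR "nat list"

datatype 'f label = TermL "'f ttree" | ClauseL "'f clause" | RVarL rvar

type_synonym 'f rtree = "nat list \<rightharpoonup> 'f label"

text \<open>The words are reversed, so that the recursion goes from a node to its parent.
  The argument \<open>b\<close> is the address of the root. It is the empty word for a rewriting tree proper;
  when a rewriting tree is grafted at node \<open>b\<close> of another one, its nodes \<open>v\<close> become the nodes
  \<open>bv\<close>, and the variables in \<open>V\<^sub>E\<close> and \<open>V\<^sub>R\<close> have to be indexed accordingly.
  The body atom \<open>\<sigma>(\<theta>(P(i)(j)))\<close> below an or-node is the \<open>j\<close>-th body atom of the label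
  \<open>\<sigma>(\<theta>(P(i)))\<close> of that or-node.\<close>

fun rew_rev ::
  "'f signature \<Rightarrow> nat list \<Rightarrow> 'f clause list \<Rightarrow> 'f clause \<Rightarrow> 'f subst \<Rightarrow> 'f rtree" where
  "rew_rev \<Sigma> b P C \<sigma> [] = Some (ClauseL (csubst \<sigma> C))"
| "rew_rev \<Sigma> b P C \<sigma> (i # w) =
     (case rew_rev \<Sigma> b P C \<sigma> w of
        Some (ClauseL D) \<Rightarrow> if i < length (body D) then Some (TermL (body D ! i)) else None
      | Some (TermL t) \<Rightarrow>
          if i < length P
          then (case node_instance \<Sigma> (P ! i) t (b @ rev (i # w)) of
                  Some D \<Rightarrow> Some (ClauseL (csubst \<sigma> D))
                | None \<Rightarrow> Some (RVarL (VR (b @ rev (i # w)))))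
          else None
      | _ \<Rightarrow> None)"

definition rew_at ::
  "'f signature \<Rightarrow> nat list \<Rightarrow> 'f clause list \<Rightarrow> 'f clause \<Rightarrow> 'f subst \<Rightarrow> 'f rtree" where
  "rew_at \<Sigma> b P C \<sigma> w = rew_rev \<Sigma> b P C \<sigma> (rev w)"

definition rew :: "'f signature \<Rightarrow> 'f clause list \<Rightarrow> 'f clause \<Rightarrow> 'f subst \<Rightarrow> 'f rtree" where
  "rew \<Sigma> P C \<sigma> = rew_at \<Sigma> [] P C \<sigma>"

lemma rew_at_Nil: "rew_at \<Sigma> b P C \<sigma> [] = Some (ClauseL (csubst \<sigma> C))"
  by (simp add: rew_at_def)

lemma rew_at_snoc:
  "rew_at \<Sigma> b P C \<sigma> (w @ [i]) =
     (case rew_at \<Sigma> b P C \<sigma> w of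
        Some (ClauseL D) \<Rightarrow> if i < length (body D) then Some (TermL (body D ! i)) else None
      | Some (TermL t) \<Rightarrow>
          if i < length P
          then (case node_instance \<Sigma> (P ! i) t (b @ w @ [i]) of
                  Some D \<Rightarrow> Some (ClauseL (csubst \<sigma> D))
                | None \<Rightarrow> Some (RVarL (VR (b @ w @ [i]))))
          else None
      | _ \<Rightarrow> None)"
  by (auto simp: rew_at_def split: option.splits label.splits)


section \<open>Tier 2 substitution\<close>

fun label_subst :: "'f subst \<Rightarrow> 'f label \<Rightarrow> 'f label" where
  "label_subst \<sigma> (TermL t) = TermL (tsubst \<sigma> t)"
| "label_subst \<sigma> (ClauseL C) = ClauseL (csubst \<sigma> C)"
| "label_subst \<sigma> (RVarL X) = RVarL X"

text \<open>The value of \<open>\<sigma>'(T)\<close> at the word \<open>wiv\<close>, where \<open>T(wi)\<close> is a variable in \<open>V\<^sub>R\<close>; then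
  \<open>w\<close> is an and-node and \<open>(\<sigma>'(T))(w) = \<sigma>'(T(w))\<close>.\<close>

definition graft ::
  "'f signature \<Rightarrow> 'f clause list \<Rightarrow> 'f subst \<Rightarrow> 'f subst \<Rightarrow> 'f rtree \<Rightarrow>
   nat list \<Rightarrow> nat \<Rightarrow> nat list \<Rightarrow> 'f label option" where
  "graft \<Sigma> P \<sigma> \<sigma>' T w i v =
     (case T w of
        Some (TermL t) \<Rightarrow>
          (case node_instance \<Sigma> (P ! i) (tsubst \<sigma>' t) (w @ [i]) of
             Some D \<Rightarrow> rew_at \<Sigma> (w @ [i]) P D (\<sigma>' \<odot> \<sigma>) v
           | None \<Rightarrow> if v = [] then T (w @ [i]) else None)
      | _ \<Rightarrow> None)"

text \<open>\<open>\<sigma>'(T)\<close> for \<open>T = rew(P, C, \<sigma>)\<close>. It depends on \<open>P\<close> and \<open>\<sigma>\<close>, which \<open>T\<close> does not determine.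
  Nodes labelled in \<open>V\<^sub>R\<close> are leaves of \<open>T\<close>, so the description is definite: a word has at most
  one prefix \<open>wi\<close> of this kind.\<close>

definition tier2_subst ::
  "'f signature \<Rightarrow> 'f clause list \<Rightarrow> 'f subst \<Rightarrow> 'f subst \<Rightarrow> 'f rtree \<Rightarrow> 'f rtree" where
  "tier2_subst \<Sigma> P \<sigma> \<sigma>' T u =
     (if \<exists>w i v X. u = w @ [i] @ v \<and> T (w @ [i]) = Some (RVarL X)
      then (THE l. \<exists>w i v X. u = w @ [i] @ v \<and> T (w @ [i]) = Some (RVarL X) \<and>
                             l = graft \<Sigma> P \<sigma> \<sigma>' T w i v)
      else map_option (label_subst \<sigma>') (T u))"

end

theory Submission
  imports Defs
begin

text \<open>Every and-node of \<open>T = rew(P, C, \<sigma>)\<close> is labelled by an instance under \<open>\<sigma>\<close>, hence by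
  idempotence by a fixed point of \<open>\<sigma>\<close>, and its image under \<open>\<theta>\<close> is a fixed point of \<open>\<theta>\<sigma>\<close>.
  If \<open>\<tau>\<close> matches a head \<open>h\<close> against such a label \<open>t\<close>, then so does \<open>\<sigma>\<tau>\<close>, while \<open>\<theta>\<tau>\<close> and
  \<open>\<theta>\<sigma>\<theta>\<tau>\<close> both match \<open>h\<close> against \<open>\<theta>(t)\<close>. As matchers are determined on the variables of \<open>h\<close>,
  \<open>\<theta>\<sigma>\<theta>\<tau>\<close> and \<open>\<theta>\<sigma>\<tau>\<close> agree there; the existential variables become \<open>E\<^sup>k\<^sub>w\<close> on both sides before
  \<open>\<theta>\<sigma>\<close> is applied. So the trees agree wherever \<open>T\<close> has no variable in \<open>V\<^sub>R\<close>. Below such a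
  variable both trees rewrite the same clause with \<open>\<theta>\<sigma>\<close>.\<close>

section \<open>Term trees under substitution\<close>

lemma tsubst_var_root: "t [] = Some (V x) \<Longrightarrow> tsubst \<sigma> t = \<sigma> x"
proof
  fix w show "t [] = Some (V x) \<Longrightarrow> tsubst \<sigma> t w = \<sigma> x w" by (cases w) auto
qed

lemma tsubst_tvar [simp]: "tsubst \<sigma> (tvar x) = \<sigma> x"
  by (rule tsubst_var_root) (simp add: tvar_def)

text \<open>Beyond the arity of the root, the subtree \<open>\<lambda>v. t (i # v)\<close> is the
  empty map rather than a term tree; \<open>tsubst\<close> still has to be evaluated there.\<close>

lemma tsubst_empty: "tsubst \<sigma> (\<lambda>v. None) w = None"
  by (induction w) auto

lemma tsubst_fn_root:
  assumes "t [] = Some (Fn f)"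
  shows "(\<lambda>v. tsubst \<sigma> t (i # v)) = tsubst \<sigma> (\<lambda>v. t (i # v))"
  using assms by auto

text \<open>The recursion of \<open>tsubst\<close> follows the address, so induction on the address
  works for arbitrary partial maps, without a term structure.\<close>

lemma tsubst_comp: "tsubst (\<tau> \<odot> \<sigma>) t = tsubst \<tau> (tsubst \<sigma> t)"
proof
  fix w show "tsubst (\<tau> \<odot> \<sigma>) t w = tsubst \<tau> (tsubst \<sigma> t) w"
  proof (induction w arbitrary: t)
    case Nil
    show ?case
      by (cases "\<exists>x. t [] = Some (V x)")
        (auto simp: tsubst_var_root comp_subst_def split: option.splits sym.splits)
  next
    case (Cons i w)
    show ?case
    proof (cases "\<exists>x. t [] = Some (V x)")
      case True
      then obtain x where "t [] = Some (V x)" by blast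
      then show ?thesis by (simp only: tsubst_var_root comp_subst_def)
    next
      case False
      then have sub: "(\<lambda>v. tsubst \<sigma> t (i # v)) = tsubst \<sigma> (\<lambda>v. t (i # v))"
        and root: "tsubst \<sigma> t [] = t []"
        by (auto split: option.splits sym.splits)
      have "tsubst (\<tau> \<odot> \<sigma>) t (i # w) = tsubst (\<tau> \<odot> \<sigma>) (\<lambda>v. t (i # v)) w"
        using False by (auto split: option.splits sym.splits)
      also have "\<dots> = tsubst \<tau> (\<lambda>v. tsubst \<sigma> t (i # v)) w"
        by (simp only: sub Cons.IH)
      also have "\<dots> = tsubst \<tau> (tsubst \<sigma> t) (i # w)"
        using False root by (auto split: option.splits sym.splits)
      finally show ?thesis .
    qed
  qed
qed

lemma csubst_comp: "csubst (\<tau> \<odot> \<sigma>) C = csubst \<tau> (csubst \<sigma> C)"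
proof -
  have "tsubst (\<tau> \<odot> \<sigma>) = tsubst \<tau> \<circ> tsubst \<sigma>" by (rule ext) (simp add: tsubst_comp)
  then show ?thesis by (simp add: csubst_def option.map_comp)
qed

lemma tsubst_idem: "idem \<sigma> \<Longrightarrow> tsubst \<sigma> (tsubst \<sigma> t) = tsubst \<sigma> t"
  by (simp add: idem_def flip: tsubst_comp)

lemma tree_language_subtree: "tree_language L \<Longrightarrow> tree_language {v. i # v \<in> L}"
  unfolding tree_language_def by (simp flip: append_Cons)

section \<open>Inductive structure of finite term trees\<close>

text \<open>Passes from tree languages to the algebraic view of a term as a variable or a symbol
  applied to terms. The children of the root form a finite downward closed set, hence an initial
  segment, and the arity condition fixes its length.\<close>

lemma Term_root_cases:
  assumes "t \<in> Term \<Sigma>"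
  obtains x where "t = tvar x"
  | f n where "t [] = Some (Fn f)" "\<Sigma> f = Some n"
      "\<And>i. i < n \<Longrightarrow> (\<lambda>v. t (i # v)) \<in> Term \<Sigma>" "\<And>i v. n \<le> i \<Longrightarrow> t (i # v) = None"
proof -
  have L: "tree_language (dom t)" and ne: "dom t \<noteq> {}" and fin: "finite (dom t)"
    and ar: "\<And>w s. t w = Some s \<Longrightarrow> has_arity \<Sigma> s (card {i. w @ [i] \<in> dom t})"
    using assms by (auto simp: Term_def term_tree_def)
  from ne obtain w where "w \<in> dom t" by blast
  then have root: "[] \<in> dom t" using tree_language_prefix[OF L, of "[]" w] by simp
  let ?I = "{i. [i] \<in> dom t}"
  have finI: "finite ?I"
    using L root unfolding tree_language_def by (metis (no_types, lifting) append_Nil Collect_cong)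
  have down: "i \<in> ?I" if "j \<in> ?I" "i < j" for i j
    using L that unfolding tree_language_def by (metis append_Nil mem_Collect_eq)
  have pre: "i \<in> ?I" if "i # v \<in> dom t" for i v
    using tree_language_prefix[OF L, of "[i]" v] that by simp
  have I: "?I = {..<card ?I}"
  proof -
    \<comment> \<open>A finite set of naturals closed under smaller elements ends at its least
      non-member.\<close>
    have "?I = {..<(LEAST n. n \<notin> ?I)}"
    proof -
      have ex: "\<exists>n. n \<notin> ?I" using finI ex_new_if_finite infinite_UNIV_nat by blast
      show ?thesis
        using LeastI_ex[OF ex] not_less_Least down by (metis (no_types, lifting) lessThan_iff linorder_neqE_nat set_eqI)
    qed
    then show ?thesis by (metis card_lessThan)
  qed
  from root obtain s where s: "t [] = Some s" by blast
  then have ars: "has_arity \<Sigma> s (card ?I)" using ar[of "[]" s] by simp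
  show ?thesis
  proof (cases s)
    case (V x)
    with ars finI have "?I = {}" by simp
    have "t w = tvar x w" for w
      using pre s V \<open>?I = {}\<close> by (cases w) (auto simp: tvar_def)
    then show ?thesis using that(1) by blast
  next
    case (Fn f)
    show ?thesis
    proof (rule that(2))
      show "t [] = Some (Fn f)" using s Fn by simp
      show "\<Sigma> f = Some (card ?I)" using ars Fn by simp
      show "t (i # v) = None" if "card ?I \<le> i" for i v
        proof -
          have "i \<notin> ?I" using I that by (metis lessThan_iff not_less)
          then show ?thesis using pre[of i v] by auto
        qed
      show "(\<lambda>v. t (i # v)) \<in> Term \<Sigma>" if "i < card ?I" for i
      proof -
        have d: "dom (\<lambda>v. t (i # v)) = {v. i # v \<in> dom t}" by auto
        have "i \<in> ?I" using I that by blast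
        then have "[] \<in> dom (\<lambda>v. t (i # v))" by auto
        moreover have "finite (dom (\<lambda>v. t (i # v)))"
          unfolding d using fin by (rule finite_vimageI[of _ "(#) i", unfolded vimage_def]) simp
        moreover have "tree_language (dom (\<lambda>v. t (i # v)))"
          unfolding d using L by (rule tree_language_subtree)
        moreover have "has_arity \<Sigma> s (card {j. w @ [j] \<in> dom (\<lambda>v. t (i # v))})"
          if "t (i # w) = Some s" for w s
          using ar[OF that] by (simp add: d)
        ultimately show ?thesis unfolding Term_def term_tree_def by blast
      qed
    qed
  qed
qed

text \<open>Converse of the second case of \<open>Term_root_cases\<close>: each condition at a
  non-root node is inherited from the immediate subtree containing it.\<close>

lemma Term_fn_rootI:
  assumes "t [] = Some (Fn f)" and "\<Sigma> f = Some n"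
    and sub: "\<And>i. i < n \<Longrightarrow> (\<lambda>v. t (i # v)) \<in> Term \<Sigma>"
    and out: "\<And>i v. n \<le> i \<Longrightarrow> t (i # v) = None"
  shows "t \<in> Term \<Sigma>"
proof -
  have L: "tree_language {v. i # v \<in> dom t}" and fin: "finite {v. i # v \<in> dom t}"
    and ne: "{v. i # v \<in> dom t} \<noteq> {}"
    and ar: "\<And>w s. t (i # w) = Some s \<Longrightarrow> has_arity \<Sigma> s (card {j. i # w @ [j] \<in> dom t})"
    if "i < n" for i
    using sub[OF that] by (auto simp: Term_def term_tree_def dom_def)
  have lt: "i < n" if "i # v \<in> dom t" for i v
    using that out[of i v] by (cases "i < n") auto
  have children: "[i] \<in> dom t \<longleftrightarrow> i < n" for i
  proof
    assume "i < n"
    from ne[OF this] obtain v where "[] @ v \<in> {v. i # v \<in> dom t}" by fastforce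
    with tree_language_prefix[OF L[OF \<open>i < n\<close>]] show "[i] \<in> dom t" by blast
  qed (rule lt)
  have "tree_language (dom t)"
    unfolding tree_language_def
  proof (intro conjI allI impI ballI)
    fix w j assume j: "w @ [j] \<in> dom t"
    show "w \<in> dom t"
    proof (cases w)
      case (Cons i v)
      then show ?thesis using j L[OF lt, of i "v @ [j]"] by (auto simp: tree_language_def)
    qed (use assms(1) in auto)
    show "w @ [k] \<in> dom t" if "k < j" for k
    proof (cases w)
      case Nil
      then show ?thesis using j that children by auto
    next
      case (Cons i v)
      then show ?thesis using j that L[OF lt, of i "v @ [j]"] by (auto simp: tree_language_def)
    qed
  next
    fix w assume w: "w \<in> dom t"
    show "finite {i. w @ [i] \<in> dom t}"
    proof (cases w)
      case Nil
      then show ?thesis using children by simp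
    next
      case (Cons i v)
      then show ?thesis using w L[OF lt, of i v] by (auto simp: tree_language_def)
    qed
  qed
  moreover have "has_arity \<Sigma> s (card {i. w @ [i] \<in> dom t})" if w: "t w = Some s" for w s
  proof (cases w)
    case Nil
    then show ?thesis using w assms(1,2) children by auto
  next
    case (Cons i v)
    then show ?thesis using w ar[OF lt, of i v v s] by auto
  qed
  moreover have "finite (dom t)"
  proof (rule finite_subset)
    show "dom t \<subseteq> {[]} \<union> (\<Union>i<n. (#) i ` {v. i # v \<in> dom t})"
    proof
      fix w assume "w \<in> dom t"
      then show "w \<in> {[]} \<union> (\<Union>i<n. (#) i ` {v. i # v \<in> dom t})"
        using lt by (cases w) auto
    qed
    show "finite ({[]} \<union> (\<Union>i<n. (#) i ` {v. i # v \<in> dom t}))" using fin by auto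
  qed
  ultimately show ?thesis using assms(1) by (auto simp: Term_def term_tree_def)
qed

lemma Term_tvar [simp]: "tvar x \<in> Term \<Sigma>"
  by (auto simp: tvar_def Term_def term_tree_def tree_language_def)

lemma Term_induct [consumes 1, case_names Var Fn]:
  assumes "t \<in> Term \<Sigma>"
    and Var: "\<And>x. Q (tvar x)"
    and Fn: "\<And>t f n. t [] = Some (Fn f) \<Longrightarrow> \<Sigma> f = Some n \<Longrightarrow>
      (\<And>i. i < n \<Longrightarrow> (\<lambda>v. t (i # v)) \<in> Term \<Sigma>) \<Longrightarrow> (\<And>i. i < n \<Longrightarrow> Q (\<lambda>v. t (i # v))) \<Longrightarrow>
      (\<And>i v. n \<le> i \<Longrightarrow> t (i # v) = None) \<Longrightarrow> Q t"
  shows "Q t"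
  using assms(1)
proof (induction "card (dom t)" arbitrary: t rule: less_induct)
  case less
  from less.prems show ?case
  proof (cases rule: Term_root_cases)
    case (2 f n)
    have "Q (\<lambda>v. t (i # v))" if "i < n" for i
    proof (rule less.hyps)
      have fin: "finite (dom t)" using less.prems by (simp add: Term_def)
      \<comment> \<open>Prefixing addresses with \<open>i\<close> is injective and misses the root,
        so an immediate subtree has strictly fewer nodes.\<close>
      have "card (dom (\<lambda>v. t (i # v))) = card ((#) i ` dom (\<lambda>v. t (i # v)))"
        by (simp add: card_image)
      also have "\<dots> < card (dom t)"
        using 2(1) by (intro psubset_card_mono[OF fin]) auto
      finally show "card (dom (\<lambda>v. t (i # v))) < card (dom t)" .
    qed (use 2(3) that in blast)
    then show ?thesis using Fn 2 by blast
  qed (use Var in blast)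
qed

lemma tsubst_Term:
  assumes "t \<in> Term \<Sigma>" and "is_subst \<Sigma> \<sigma>"
  shows "tsubst \<sigma> t \<in> Term \<Sigma>"
  using assms(1)
proof (induction rule: Term_induct)
  case (Var x)
  then show ?case using assms(2) by (simp add: is_subst_def)
next
  case (Fn t f n)
  show ?case
  proof (rule Term_fn_rootI)
    show "(\<lambda>v. tsubst \<sigma> t (i # v)) \<in> Term \<Sigma>" if "i < n" for i
      unfolding tsubst_fn_root[where t = t and f = f, OF Fn(1)] using Fn.IH that by blast
    show "tsubst \<sigma> t (i # v) = None" if "n \<le> i" for i v
      using that Fn(1,4) by (simp add: tsubst_empty)
  qed (use Fn in auto)
qed

lemma is_subst_comp: "is_subst \<Sigma> \<tau> \<Longrightarrow> is_subst \<Sigma> \<sigma> \<Longrightarrow> is_subst \<Sigma> (\<tau> \<odot> \<sigma>)"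
  by (simp add: is_subst_def comp_subst_def tsubst_Term)

text \<open>Membership in \<open>Term \<Sigma>\<close> matters: substituting at a variable discards
  whatever a general partial map has below it.\<close>

lemma tsubst_tvar_id:
  assumes "t \<in> Term \<Sigma>"
  shows "tsubst tvar t = t"
  using assms
proof (induction rule: Term_induct)
  case (Fn t f n)
  show ?case
  proof
    fix w show "tsubst tvar t w = t w"
    proof (cases w)
      case (Cons i v)
      then show ?thesis using Fn by (cases "i < n") (auto simp: not_less tsubst_empty)
    qed (use Fn in auto)
  qed
qed simp

lemma finite_tvars:
  assumes "t \<in> Term \<Sigma>"
  shows "finite (tvars t)"
proof (rule finite_subset)
  show "tvars t \<subseteq> (\<lambda>w. case t w of Some (V x) \<Rightarrow> x) ` dom t"
    by (force simp: tvars_def image_iff)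
  show "finite \<dots>" using assms by (simp add: Term_def)
qed


section \<open>Existence of most general matchers\<close>

lemma inj_avoiding_finite:
  assumes "finite (F :: var set)"
  obtains r :: "var \<Rightarrow> var" where "inj r" "range r \<inter> F = {}"
proof -
  define idx where "idx x = (case x of VU n \<Rightarrow> n | VE w n \<Rightarrow> n)" for x
  \<comment> \<open>\<open>sum idx F\<close> bounds the index of every variable in \<open>F\<close>,
    so the shift moves all indices strictly above them.\<close>
  define r where "r x = (case x of VU n \<Rightarrow> VU (Suc n + sum idx F) | VE w n \<Rightarrow> VE w (Suc n + sum idx F))"
    for x
  have "inj r" by (auto simp: inj_def r_def split: var.splits)
  moreover have "r x \<notin> F" for x
  proof
    assume "r x \<in> F"
    then have "idx (r x) \<le> sum idx F" using assms by (simp add: member_le_sum)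
    then show False by (cases x) (auto simp: idx_def r_def)
  qed
  ultimately show thesis using that by blast
qed

text \<open>A most general matcher is compared with other matchers on all variables. So those outside
  \<open>h\<close> have to be renamed away from the variables that the matcher introduces.\<close>

lemma mgm_exists:
  assumes h: "h \<in> Term \<Sigma>" and "matcher \<Sigma> \<tau> h t"
  shows "\<exists>\<mu>. mgm \<Sigma> \<mu> h t"
proof -
  have \<tau>t: "tsubst \<tau> h = t" and \<tau>: "\<And>x. \<tau> x \<in> Term \<Sigma>"
    using assms(2) by (auto simp: matcher_def is_subst_def)
  have "finite (\<Union>x\<in>tvars h. tvars (\<tau> x))"
    using finite_tvars[OF h] finite_tvars[OF \<tau>] by blast
  then obtain r :: "var \<Rightarrow> var" where r: "inj r" "range r \<inter> (\<Union>x\<in>tvars h. tvars (\<tau> x)) = {}"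
    using inj_avoiding_finite by blast
  define \<mu> where "\<mu> x = (if x \<in> tvars h then \<tau> x else tvar (r x))" for x
  have "tsubst \<mu> h = t"
    using \<tau>t tsubst_cong[of h \<mu> \<tau>] by (simp add: \<mu>_def)
  then have "matcher \<Sigma> \<mu> h t"
    using \<tau> by (simp add: matcher_def is_subst_def \<mu>_def)
  moreover have "more_general \<Sigma> \<mu> \<tau>'" if "matcher \<Sigma> \<tau>' h t" for \<tau>'
  proof -
    have \<tau>'t: "tsubst \<tau>' h = t" and \<tau>': "\<And>x. \<tau>' x \<in> Term \<Sigma>"
      using that by (auto simp: matcher_def is_subst_def)
    \<comment> \<open>Undoes the renaming \<open>r\<close> and then applies \<open>\<tau>'\<close>.
      It is the identity on the variables that \<open>\<tau>\<close> introduces into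
      \<open>h\<close>, since \<open>r\<close> avoids them.\<close>
    define \<rho> where "\<rho> y = (if y \<in> range r then \<tau>' (inv r y) else tvar y)" for y
    have "tsubst \<rho> (\<mu> x) = \<tau>' x" for x
    proof (cases "x \<in> tvars h")
      case True
      have "tsubst \<rho> (\<tau> x) = tsubst tvar (\<tau> x)"
        using True r(2) by (intro tsubst_cong) (auto simp: \<rho>_def)
      also have "\<dots> = \<tau> x" using \<tau> by (rule tsubst_tvar_id)
      also have "\<dots> = \<tau>' x" by (rule matchers_agree[OF h _ True]) (simp add: \<tau>t \<tau>'t)
      finally show ?thesis using True by (simp add: \<mu>_def)
    next
      case False
      then show ?thesis using r(1) by (simp add: \<mu>_def \<rho>_def)
    qed
    moreover have "is_subst \<Sigma> \<rho>" using \<tau>' by (simp add: is_subst_def \<rho>_def)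
    ultimately show ?thesis unfolding more_general_def comp_subst_def by blast
  qed
  ultimately show ?thesis unfolding mgm_def by blast
qed


section \<open>Rewriting trees under substitution\<close>

text \<open>A variable of \<open>K\<close> is existential or occurs in the head. The former are
  covered by \<open>ex\<close>, the latter by \<open>agree\<close>, because an instance of
  \<open>h\<close> determines the substitution on the variables of \<open>h\<close>.\<close>

lemma csubst_node_subst:
  assumes K: "is_clause \<Sigma> K" "head K = Some h"
    and agree: "tsubst (\<rho> \<odot> \<mu>) h = tsubst (\<rho>' \<odot> \<mu>') h"
    and ex: "\<And>x. x \<in> existentials K \<Longrightarrow> \<rho> (VE w (ex_index K x)) = \<rho>' (VE w (ex_index K x))"
  shows "csubst \<rho> (csubst (node_subst \<mu> K w) K) = csubst \<rho>' (csubst (node_subst \<mu>' K w) K)"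
proof -
  have "(\<rho> \<odot> node_subst \<mu> K w) x = (\<rho>' \<odot> node_subst \<mu>' K w) x"
    if "x \<in> tvars h \<or> (\<exists>t\<in>set (body K). x \<in> tvars t)" for x
  proof (cases "x \<in> existentials K")
    case True
    then show ?thesis using ex by (simp add: comp_subst_def node_subst_def)
  next
    case False
    then have "x \<in> tvars h" using that K(2) by (auto simp: existentials_def)
    moreover have "h \<in> Term \<Sigma>" using K by (simp add: is_clause_def)
    ultimately have "(\<rho> \<odot> \<mu>) x = (\<rho>' \<odot> \<mu>') x" by (intro matchers_agree[OF _ agree])
    then show ?thesis using False by (simp add: comp_subst_def node_subst_def)
  qed
  then show ?thesis
    using K(2) unfolding csubst_comp[symmetric] by (auto simp: csubst_def intro!: tsubst_cong)
qed

lemma node_instance_tsubst: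
  assumes K: "is_clause \<Sigma> K" "head K = Some h" and \<theta>: "is_subst \<Sigma> \<theta>"
    and D: "node_instance \<Sigma> K t w = Some D"
    and fix_t: "tsubst \<sigma> t = t" and fix_\<theta>t: "tsubst (\<theta> \<odot> \<sigma>) (tsubst \<theta> t) = tsubst \<theta> t"
  obtains D' where "node_instance \<Sigma> K (tsubst \<theta> t) w = Some D'"
    and "csubst (\<theta> \<odot> \<sigma>) D' = csubst \<theta> (csubst \<sigma> D)"
proof -
  from D K(2) obtain \<mu> where \<mu>: "mgm \<Sigma> \<mu> h t"
    by (auto simp: node_instance_def split: if_splits)
  then have m: "is_subst \<Sigma> \<mu>" "tsubst \<mu> h = t" by (auto simp: mgm_def matcher_def)
  have "h \<in> Term \<Sigma>" using K by (simp add: is_clause_def)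
  \<comment> \<open>This only matches; \<open>mgm_exists\<close> then supplies an mgm, which may
    differ from \<open>\<theta> \<odot> \<mu>\<close> outside \<open>h\<close>.\<close>
  moreover have "matcher \<Sigma> (\<theta> \<odot> \<mu>) h (tsubst \<theta> t)"
    using m \<theta> by (simp add: matcher_def is_subst_comp tsubst_comp)
  ultimately obtain \<mu>' where \<mu>': "mgm \<Sigma> \<mu>' h (tsubst \<theta> t)" using mgm_exists by blast
  then have m': "tsubst \<mu>' h = tsubst \<theta> t" by (simp add: mgm_def matcher_def)
  have "csubst (\<theta> \<odot> \<sigma>) (csubst (node_subst \<mu>' K w) K) = csubst (\<theta> \<odot> \<sigma>) (csubst (node_subst \<mu> K w) K)"
  proof (rule csubst_node_subst[OF K])
    \<comment> \<open>Both sides equal \<open>tsubst \<theta> t\<close>: the left by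
      \<open>fix_\<theta>t\<close>, the right by \<open>fix_t\<close>.\<close>
    show "tsubst (\<theta> \<odot> \<sigma> \<odot> \<mu>') h = tsubst (\<theta> \<odot> \<sigma> \<odot> \<mu>) h"
      using m(2) m' fix_t fix_\<theta>t by (simp add: tsubst_comp)
  qed simp
  moreover have "D = csubst (node_subst \<mu> K w) K"
    using D node_instance_eq[OF K \<mu>] by simp
  ultimately show thesis
    using that[OF node_instance_eq[OF K \<mu>']] by (simp add: csubst_comp)
qed

section \<open>Grafting and the leaves labelled in \<open>V_R\<close>\<close>

text \<open>A label depends only on the label of the parent and on the absolute address, and
  \<open>b @ u\<close> as new base keeps absolute addresses unchanged. So the tree below
  \<open>u\<close> is the one grown from \<open>D\<close>, with the same existential
  variables.\<close>

lemma rew_at_graft: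
  assumes "rew_at \<Sigma> b P C \<sigma> u = Some (ClauseL (csubst \<sigma> D))"
  shows "rew_at \<Sigma> b P C \<sigma> (u @ v) = rew_at \<Sigma> (b @ u) P D \<sigma> v"
proof (induction v rule: rev_induct)
  case Nil
  then show ?case using assms by (simp add: rew_at_Nil)
next
  case (snoc i v)
  then show ?case
    using rew_at_snoc[of \<Sigma> b P C \<sigma> "u @ v" i] by (simp add: rew_at_snoc cong: option.case_cong label.case_cong if_cong)
qed

lemma rew_at_append_None: "rew_at \<Sigma> b P C \<sigma> u = None \<Longrightarrow> rew_at \<Sigma> b P C \<sigma> (u @ v) = None"
proof (induction v rule: rev_induct)
  case (snoc i v)
  then show ?case using rew_at_snoc[of \<Sigma> b P C \<sigma> "u @ v" i] by simp
qed simp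

lemma rew_at_below_RVarL:
  assumes "rew_at \<Sigma> b P C \<sigma> u = Some (RVarL X)" and "v \<noteq> []"
  shows "rew_at \<Sigma> b P C \<sigma> (u @ v) = None"
proof -
  from assms(2) obtain i v' where v: "v = i # v'" by (cases v) auto
  have "rew_at \<Sigma> b P C \<sigma> (u @ [i]) = None" using assms(1) by (simp add: rew_at_snoc)
  then show ?thesis using rew_at_append_None[of \<Sigma> b P C \<sigma> "u @ [i]" v'] v by simp
qed

text \<open>Two prefixes of one word are comparable, and a node labelled in \<open>V_R\<close> has
  no proper descendants. This makes the definite description in \<open>tier2_subst\<close>
  meaningful.\<close>

lemma rew_at_RVarL_prefix_unique:
  assumes "u @ v = u' @ v'"
    and "rew_at \<Sigma> b P C \<sigma> u = Some (RVarL X)" and "rew_at \<Sigma> b P C \<sigma> u' = Some (RVarL X')"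
  shows "u = u'"
proof -
  from assms(1) obtain z where "u = u' @ z \<or> u' = u @ z" by (auto simp: append_eq_append_conv2)
  then show ?thesis
    using assms(2,3) rew_at_below_RVarL[of \<Sigma> b P C \<sigma> _ _ z] by (cases "z = []") auto
qed

lemma rew_at_RVarLD:
  assumes "rew_at \<Sigma> b P C \<sigma> (w @ [i]) = Some (RVarL X)"
  obtains t where "rew_at \<Sigma> b P C \<sigma> w = Some (TermL t)" and "i < length P"
    and "X = VR (b @ w @ [i])"
  using assms by (auto simp: rew_at_snoc split: option.splits label.splits if_splits)

text \<open>An and-node carries a body atom of its parent, and every clause label is a
  \<sigma>-instance. With idempotence this gives the fixed points needed for
  \<open>node_instance_tsubst\<close>.\<close>

lemma rew_at_TermL_instance:
  assumes "rew_at \<Sigma> b P C \<sigma> w = Some (TermL t)"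
  obtains s where "t = tsubst \<sigma> s"
proof (cases w rule: rev_cases)
  case Nil
  then show ?thesis using assms by (simp add: rew_at_Nil)
next
  case (snoc v i)
  have "\<exists>D. rew_at \<Sigma> b P C \<sigma> v = Some (ClauseL (csubst \<sigma> D))"
    if "rew_at \<Sigma> b P C \<sigma> v = Some (ClauseL E)" for E
    using that by (cases v rule: rev_cases)
      (auto simp: rew_at_Nil rew_at_snoc split: option.splits label.splits if_splits)
  then obtain D where "rew_at \<Sigma> b P C \<sigma> v = Some (ClauseL (csubst \<sigma> D))"
    using assms snoc by (auto simp: rew_at_snoc split: option.splits label.splits if_splits)
  then have "t = tsubst \<sigma> (body D ! i)"
    using assms snoc by (auto simp: rew_at_snoc csubst_def split: if_splits)
  then show ?thesis by (rule that)
qed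

lemma rew_at_comp_subst:
  assumes P: "is_program \<Sigma> P" and \<theta>: "is_subst \<Sigma> \<theta>" and "idem \<sigma>" and "idem (\<theta> \<odot> \<sigma>)"
    and "\<And>w v X. u = w @ v \<Longrightarrow> rew_at \<Sigma> b P C \<sigma> w \<noteq> Some (RVarL X)"
  shows "rew_at \<Sigma> b P C (\<theta> \<odot> \<sigma>) u = map_option (label_subst \<theta>) (rew_at \<Sigma> b P C \<sigma> u)"
  using assms(5)
proof (induction u rule: rev_induct)
  case Nil
  then show ?case by (simp add: rew_at_Nil csubst_comp)
next
  case (snoc i w)
  have IH: "rew_at \<Sigma> b P C (\<theta> \<odot> \<sigma>) w = map_option (label_subst \<theta>) (rew_at \<Sigma> b P C \<sigma> w)"
    by (rule snoc.IH) (use snoc.prems in \<open>metis append.assoc\<close>)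
  have noR: "rew_at \<Sigma> b P C \<sigma> (w @ [i]) \<noteq> Some (RVarL X)" for X
    using snoc.prems[of "w @ [i]" "[]"] by simp
  show ?case
  proof (cases "\<exists>t. rew_at \<Sigma> b P C \<sigma> w = Some (TermL t) \<and> i < length P")
    case False
    \<comment> \<open>The new node is a body atom of a clause label, where substitution commutes
      with selecting the atom, or it is absent from both trees.\<close>
    then show ?thesis
      using IH by (auto simp: rew_at_snoc csubst_def split: option.splits label.splits)
  next
    case True
    then obtain t where t: "rew_at \<Sigma> b P C \<sigma> w = Some (TermL t)" and i: "i < length P" by blast
    \<comment> \<open>Without an mgm the node would be labelled in \<open>V_R\<close>, which the
      assumption on prefixes excludes.\<close>
    then obtain D where D: "node_instance \<Sigma> (P ! i) t (b @ w @ [i]) = Some D"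
      using noR by (cases "node_instance \<Sigma> (P ! i) t (b @ w @ [i])") (auto simp: rew_at_snoc)
    from t obtain s where s: "t = tsubst \<sigma> s" by (rule rew_at_TermL_instance)
    have "P ! i \<in> set P" using i by simp
    then have K: "is_clause \<Sigma> (P ! i)" and "head (P ! i) \<noteq> None"
      using P unfolding is_program_def by blast+
    then obtain h where h: "head (P ! i) = Some h" by blast
    have "tsubst \<sigma> t = t" using assms(3) s by (simp add: tsubst_idem)
    moreover have "tsubst (\<theta> \<odot> \<sigma>) (tsubst \<theta> t) = tsubst \<theta> t"
      using tsubst_idem[OF assms(4), of s] s by (simp add: tsubst_comp)
    ultimately obtain D' where "node_instance \<Sigma> (P ! i) (tsubst \<theta> t) (b @ w @ [i]) = Some D'"
      and "csubst (\<theta> \<odot> \<sigma>) D' = csubst \<theta> (csubst \<sigma> D)"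
      by (rule node_instance_tsubst[OF K h \<theta> D])
    then show ?thesis using IH t i D by (simp add: rew_at_snoc)
  qed
qed

lemma tier2_subst_rew_RVarL:
  assumes "rew \<Sigma> P C \<sigma> (w @ [i]) = Some (RVarL X)"
  shows "tier2_subst \<Sigma> P \<sigma> \<theta> (rew \<Sigma> P C \<sigma>) (w @ i # v) = graft \<Sigma> P \<sigma> \<theta> (rew \<Sigma> P C \<sigma>) w i v"
proof -
  have "(THE l. \<exists>w' i' v' X. w @ i # v = w' @ [i'] @ v' \<and>
          rew \<Sigma> P C \<sigma> (w' @ [i']) = Some (RVarL X) \<and>
          l = graft \<Sigma> P \<sigma> \<theta> (rew \<Sigma> P C \<sigma>) w' i' v') = graft \<Sigma> P \<sigma> \<theta> (rew \<Sigma> P C \<sigma>) w i v"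
  proof (rule the_equality)
    fix l
    assume "\<exists>w' i' v' X. w @ i # v = w' @ [i'] @ v' \<and>
      rew \<Sigma> P C \<sigma> (w' @ [i']) = Some (RVarL X) \<and> l = graft \<Sigma> P \<sigma> \<theta> (rew \<Sigma> P C \<sigma>) w' i' v'"
    then obtain w' i' v' X' where eq: "w @ i # v = w' @ i' # v'"
      and X': "rew \<Sigma> P C \<sigma> (w' @ [i']) = Some (RVarL X')"
      and l: "l = graft \<Sigma> P \<sigma> \<theta> (rew \<Sigma> P C \<sigma>) w' i' v'" by auto
    \<comment> \<open>Equal prefixes of the same word leave equal remainders, so
      \<open>v = v'\<close> follows as well.\<close>
    have "w @ [i] = w' @ [i']"
      by (rule rew_at_RVarL_prefix_unique) (use eq X' assms in \<open>auto simp: rew_def\<close>)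
    then show "l = graft \<Sigma> P \<sigma> \<theta> (rew \<Sigma> P C \<sigma>) w i v" using eq l by simp
  qed (use assms in auto)
  moreover have "\<exists>w' i' v' X. w @ i # v = w' @ [i'] @ v' \<and>
      rew \<Sigma> P C \<sigma> (w' @ [i']) = Some (RVarL X)"
    using assms by auto
  ultimately show ?thesis unfolding tier2_subst_def by (simp only: if_True)
qed

theorem theorem1:
  fixes \<Sigma> :: "'f signature" and P :: "'f clause list" and C :: "'f clause"
    and \<theta> \<sigma> :: "'f subst"
  assumes "dom \<Sigma> \<noteq> {}"
    and "is_program \<Sigma> P"
    and "is_clause \<Sigma> C"
    and "is_subst \<Sigma> \<theta>" and "is_subst \<Sigma> \<sigma>"
    and "idem \<sigma>" and "idem \<theta>" and "idem (\<theta> \<odot> \<sigma>)"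
  shows "tier2_subst \<Sigma> P \<sigma> \<theta> (rew \<Sigma> P C \<sigma>) = rew \<Sigma> P C (\<theta> \<odot> \<sigma>)"
proof
  fix u
  let ?T = "rew \<Sigma> P C \<sigma>" and ?T' = "rew \<Sigma> P C (\<theta> \<odot> \<sigma>)"
  note step = rew_at_comp_subst[OF assms(2,4,6,8), of _ "[]" C, folded rew_def]
  show "tier2_subst \<Sigma> P \<sigma> \<theta> ?T u = ?T' u"
  proof (cases "\<exists>w i v X. u = w @ [i] @ v \<and> ?T (w @ [i]) = Some (RVarL X)")
    case False
    have "?T w \<noteq> Some (RVarL X)" if "u = w @ v" for w v X
    proof (cases w rule: rev_cases)
      case Nil
      then show ?thesis by (simp add: rew_def rew_at_Nil)
    next
      case (snoc w' i)
      then show ?thesis using False that by auto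
    qed
    then have "?T' u = map_option (label_subst \<theta>) (?T u)" by (rule step)
    then show ?thesis unfolding tier2_subst_def using False by (simp only: if_False)
  next
    case True
    then obtain w i v X where u: "u = w @ i # v" and X: "?T (w @ [i]) = Some (RVarL X)" by auto
    from X obtain t where t: "?T w = Some (TermL t)" and i: "i < length P"
      and X_eq: "X = VR (w @ [i])"
      unfolding rew_def by (auto elim: rew_at_RVarLD)
    \<comment> \<open>The and-node \<open>w\<close> lies in the tree, so none of its prefixes is a
      leaf labelled in \<open>V_R\<close>. Hence \<open>step\<close> applies to the parent of the
      grafting point.\<close>
    have "?T w' \<noteq> Some (RVarL Y)" if "w = w' @ v'" for w' v' Y
      using that t rew_at_below_RVarL[of \<Sigma> "[]" P C \<sigma> w' Y v'] by (cases "v' = []") (auto simp: rew_def)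
    then have t': "?T' w = Some (TermL (tsubst \<theta> t))" using step[of w] t by simp
    have "graft \<Sigma> P \<sigma> \<theta> ?T w i v = ?T' (w @ i # v)"
    proof (cases "node_instance \<Sigma> (P ! i) (tsubst \<theta> t) (w @ [i])")
      case None
      \<comment> \<open>The head still fails to match after applying \<theta>. Both trees then have
        a leaf here with the same variable, since that variable is named after its node.\<close>
      then have T'R: "?T' (w @ [i]) = Some (RVarL X)"
        using t' i X_eq by (simp add: rew_def rew_at_snoc)
      then have "?T' ((w @ [i]) @ v) = None" if "v \<noteq> []"
        using that unfolding rew_def by (rule rew_at_below_RVarL)
      then show ?thesis using None t X T'R by (auto simp: graft_def)
    next
      case (Some D)
      \<comment> \<open>Here \<theta> has made a match possible. \<open>graft\<close> starts the
        subtree at the uninstantiated \<open>D\<close>, and its root label is formed with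
        \<open>\<theta> \<odot> \<sigma>\<close>, exactly as in \<open>?T'\<close>.\<close>
      then have "?T' (w @ [i]) = Some (ClauseL (csubst (\<theta> \<odot> \<sigma>) D))"
        using t' i by (simp add: rew_def rew_at_snoc)
      then have "?T' ((w @ [i]) @ v) = rew_at \<Sigma> ([] @ w @ [i]) P D (\<theta> \<odot> \<sigma>) v"
        unfolding rew_def by (rule rew_at_graft)
      then show ?thesis using Some t by (simp add: graft_def)
    qed
    then show ?thesis using tier2_subst_rew_RVarL[OF X] u by simp
  qed
qed

end
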